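(* For every $\frac{6}{5}<\delta<2$, $\alpha_*\big(\big(\frac{3}{2}-\frac{\delta}{4},\delta\big),2\big)\leq 1+\frac{\delta}{2}$.
   Context: Let $G\sim G(n,\frac12)$ be a random graph on a vertex set $V$ with $|V|=n$; logarithms are base 2. An algorithm accesses $G$ only through edge queries: querying an unordered pair $\{u,v\}$ of distinct vertices reveals whether $\{u,v\}$ is an edge of $G$. An $l$-round algorithm is deterministic and proceeds in $l$ rounds; in round $i$ it submits a set of pairs chosen as a function of the answers received in rounds $1,\dots,i-1$ (but not of answers in round $i$), and all of them are answered together. Let $G'$ be the graph on $V$ whose edges are the queried pairs answered positively. For $l\in\mathbb N$, $0<\delta_i<2$ ($1\le i\le l$) and $\alpha\le 2$, a $((\delta_1,\dots,\delta_l),l,\alpha)$-algorithm is an $l$-round algorithm making at most $n^{\delta_i}$ queries in round $i$ such that for every sufficiently large $n$, with probability at least $\frac12$ (over $G$), $G'$ contains a clique of size at least $\alpha\log n-o(\log n)$. $\alpha_*((\delta_1,\dots,\delta_l),l)$ is the supremum of $\alpha$ for which such an algorithm exists. *)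

theory Defs
  imports
    "HOL-Probability.Probability"
    "HOL-Library.Ramsey"
    "HOL-Library.Landau_Symbols"
begin

text \<open>
  A graph on the vertex set \<open>{..<n}\<close> is identified with its edge set, a subset of
  \<open>[{..<n}]\<^bsup>2\<^esup>\<close>.
\<close>

definition random_graph :: "nat \<Rightarrow> real \<Rightarrow> nat set set pmf" where
  "random_graph n p =
     map_pmf (\<lambda>b. {e \<in> [{..<n}]\<^bsup>2\<^esup>. b e})
       (Pi_pmf ([{..<n}]\<^bsup>2\<^esup>) False (\<lambda>_. bernoulli_pmf p))"

text \<open>
  A deterministic strategy maps the answers of the completed rounds, in chronological
  order, to the set of pairs queried next. The answer to a round is the set of queried
  pairs that are edges; since the strategy is deterministic, the earlier answers
  determine the earlier query sets, so the history need not record the latter.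
\<close>

type_synonym strategy = "nat set set list \<Rightarrow> nat set set"

fun answers :: "strategy \<Rightarrow> nat set set \<Rightarrow> nat \<Rightarrow> nat set set list" where
  "answers Q E 0 = []"
| "answers Q E (Suc i) = answers Q E i @ [Q (answers Q E i) \<inter> E]"

text \<open>Rounds are numbered from 0.\<close>

definition queries :: "strategy \<Rightarrow> nat set set \<Rightarrow> nat \<Rightarrow> nat set set" where
  "queries Q E i = Q (answers Q E i)"

definition revealed_graph :: "strategy \<Rightarrow> nat set set \<Rightarrow> nat \<Rightarrow> nat set set" where
  "revealed_graph Q E l = (\<Union>i<l. queries Q E i \<inter> E)"

text \<open>
  An algorithm is a family of strategies, one for each number of vertices; the function
  \<open>f\<close> is the \<open>o(log n)\<close> error term.
\<close>

definition is_clique_algorithm ::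
    "real list \<Rightarrow> nat \<Rightarrow> real \<Rightarrow> (nat \<Rightarrow> strategy) \<Rightarrow> bool" where
  "is_clique_algorithm \<delta>s l \<alpha> A \<longleftrightarrow>
     length \<delta>s = l \<and> (\<forall>i<l. 0 < \<delta>s ! i \<and> \<delta>s ! i < 2) \<and> \<alpha> \<le> 2 \<and>
     (\<forall>n. \<forall>E \<subseteq> [{..<n}]\<^bsup>2\<^esup>. \<forall>i<l.
        queries (A n) E i \<subseteq> [{..<n}]\<^bsup>2\<^esup> \<and>
        real (card (queries (A n) E i)) \<le> real n powr (\<delta>s ! i)) \<and>
     (\<exists>f :: nat \<Rightarrow> real. f \<in> o(\<lambda>n. log 2 (real n)) \<and>
        (\<forall>\<^sub>F n in sequentially.
           measure_pmf.prob (random_graph n (1/2))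
             {E. \<exists>C \<subseteq> {..<n}. clique C (revealed_graph (A n) E l) \<and>
                   real (card C) \<ge> \<alpha> * log 2 (real n) - f n} \<ge> 1/2))"

definition alpha_star :: "real list \<Rightarrow> nat \<Rightarrow> real" where
  "alpha_star \<delta>s l = Sup {\<alpha>. \<exists>A. is_clique_algorithm \<delta>s l \<alpha> A}"

text \<open>The set in the definition is nonempty and bounded, so its real \<open>Sup\<close> is the supremum.\<close>

lemma alpha_star_bdd_above: "bdd_above {\<alpha>. \<exists>A. is_clique_algorithm \<delta>s l \<alpha> A}"
  by (rule bdd_aboveI[of _ 2]) (auto simp: is_clique_algorithm_def)

lemma alpha_star_nonempty:
  assumes "length \<delta>s = l" "\<And>i. i < l \<Longrightarrow> 0 < \<delta>s ! i \<and> \<delta>s ! i < 2"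
  shows "{\<alpha>. \<exists>A. is_clique_algorithm \<delta>s l \<alpha> A} \<noteq> {}"
proof -
  have "\<exists>C\<subseteq>{..<n}. clique C F" for n :: nat and F
    by (rule exI[of _ "{}"]) simp
  then have "is_clique_algorithm \<delta>s l 0 (\<lambda>_ _. {})"
    using assms unfolding is_clique_algorithm_def queries_def
    by (auto intro!: exI[of _ "\<lambda>_. 0"] simp del: ex_simps)
  then show ?thesis by blast
qed

end

theory Submission
  imports Defs "HOL-Real_Asymp.Real_Asymp"
begin

text \<open>
  Let \<open>Q\<close> be the set of pairs queried in the first round and \<open>L = log n\<close>. In a clique \<open>C\<close> of size
  \<open>k\<close> found by the algorithm take a maximum matching \<open>M\<close> of \<open>Q\<close>-pairs, let \<open>x = 2 card M\<close>,
  \<open>S = \<Union>M\<close> and \<open>U = C - S\<close>. By maximality no pair inside \<open>U\<close> lies in \<open>Q\<close>, so all of them were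
  queried in the second round, and, as there is no augmenting path of length three, at most
  about half of the pairs between \<open>S\<close> and \<open>U\<close> lie in \<open>Q\<close>.

  There are at most \<open>n\<close> to the \<open>(3/2 - \<delta>/4) x/2\<close> choices of \<open>M\<close>. For a given \<open>M\<close> there are two union
  bounds. One may expose the first round, pay for the \<open>Q\<close>-pairs in \<open>S\<close>, choose \<open>U\<close> among the
  vertex sets spanned by \<open>k/2 - x/2\<close> disjoint pairs of the second round, and pay for the pairs of
  \<open>C\<close> outside \<open>Q\<close>; only the \<open>Q\<close>-pairs between \<open>S\<close> and \<open>U\<close> are not paid for. Or one may choose
  \<open>U\<close> among all vertex sets and pay for every pair of \<open>C\<close>. At \<open>k = (1 + \<delta>/2) L\<close> the exponent of the
  first bound is negative for \<open>x < (2 - \<delta>) L\<close> (here \<open>\<delta> > 6/5\<close> is used) and that of the second for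
  \<open>x > (2 - \<delta>) L\<close>, so for larger \<open>k\<close> the probability that such a clique is found tends to \<open>0\<close>.
\<close>

section \<open>Counting graphs with prescribed pairs and vertex sets spanned by few pairs\<close>

text \<open>Such an \<open>E\<close> is determined by its part outside \<open>Q\<close> and
  \<open>F\<close>. Divided by \<open>2 ^ card P\<close>, this is the chance that a uniformly random
  graph has first-round answers \<open>B\<close> and contains \<open>F\<close>; the multiplied form
  stays within the naturals.\<close>

lemma card_extensions_le:
  assumes "finite P" "Q \<subseteq> P" "F \<subseteq> P" "F \<inter> Q = {}"
  shows "card {E \<in> Pow P. E \<inter> Q = B \<and> F \<subseteq> E} * 2 ^ (card Q + card F) \<le> 2 ^ card P"
proof -
  have fin: "finite (P - Q - F)" using assms by blast
  have "{E \<in> Pow P. E \<inter> Q = B \<and> F \<subseteq> E} \<subseteq> (\<lambda>X. B \<union> F \<union> X) ` Pow (P - Q - F)"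
  proof
    fix E assume "E \<in> {E \<in> Pow P. E \<inter> Q = B \<and> F \<subseteq> E}"
    then have "E = B \<union> F \<union> (E - Q - F)" "E - Q - F \<in> Pow (P - Q - F)" by auto
    then show "E \<in> (\<lambda>X. B \<union> F \<union> X) ` Pow (P - Q - F)" by blast
  qed
  then have "card {E \<in> Pow P. E \<inter> Q = B \<and> F \<subseteq> E} \<le> card (Pow (P - Q - F))"
    using fin by (intro surj_card_le) auto
  also have "\<dots> = 2 ^ card (P - Q - F)" using fin by (simp add: card_Pow)
  finally have "card {E \<in> Pow P. E \<inter> Q = B \<and> F \<subseteq> E} * 2 ^ (card Q + card F)
      \<le> 2 ^ (card (P - Q - F) + (card Q + card F))"
    by (simp add: power_add)
  also have "card (P - Q - F) + (card Q + card F) = card P"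
  proof -
    have "finite Q" "finite F" using assms by (auto dest: finite_subset)
    then have "card (Q \<union> F) = card Q + card F" using assms(4) by (subst card_Un_disjoint) auto
    moreover have "card (P - (Q \<union> F)) = card P - card (Q \<union> F)" "card (Q \<union> F) \<le> card P"
      using assms \<open>finite Q\<close> \<open>finite F\<close> by (auto intro: card_mono card_Diff_subset)
    moreover have "P - Q - F = P - (Q \<union> F)" by blast
    ultimately show ?thesis by simp
  qed
  finally show ?thesis .
qed

text \<open>Peel off two vertices at a time: each peeled pair is one of the members of
  \<open>Q\<close>, and only an odd last vertex has to be chosen from all of
  \<open>V\<close>.\<close>

lemma card_nsets_2_subset_le:
  assumes "finite V" "finite Q"
  shows "card {U. U \<subseteq> V \<and> card U = u \<and> [U]\<^bsup>2\<^esup> \<subseteq> Q} \<le> card Q ^ (u div 2) * card V ^ (u mod 2)"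
proof (induction u rule: less_induct)
  case (less u)
  let ?K = "\<lambda>u. {U. U \<subseteq> V \<and> card U = u \<and> [U]\<^bsup>2\<^esup> \<subseteq> Q}"
  have fin: "finite (?K u)" for u using assms(1) by simp
  consider "u = 0" | "u = 1" | w where "u = Suc (Suc w)"
    by (metis One_nat_def not0_implies_Suc)
  then show ?case
  proof cases
    case 1
    then have "?K u \<subseteq> {{}}" using assms(1) by (auto dest: finite_subset)
    then have "card (?K u) \<le> 1" using card_mono[of "{{}}" "?K u"] by simp
    then show ?thesis using 1 by simp
  next
    case 2
    then have "?K u \<subseteq> (\<lambda>v. {v}) ` V" by (auto simp: card_1_singleton_iff)
    then have "card (?K u) \<le> card V"
      by (rule surj_card_le[OF assms(1)])
    then show ?thesis using 2 by simp
  next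
    case (3 w)
    have "?K u \<subseteq> (\<lambda>(e, W). e \<union> W) ` (Q \<times> ?K w)"
    proof
      fix U assume U: "U \<in> ?K u"
      then have "finite U" using assms(1) finite_subset by blast
      obtain e where e: "e \<subseteq> U" "card e = 2"
        using U 3 by (auto intro: obtain_subset_with_card_n[of 2 U])
      have "finite e" using e \<open>finite U\<close> finite_subset by blast
      have "e \<in> [U]\<^bsup>2\<^esup>" using e \<open>finite e\<close> by (auto simp: nsets_def)
      then have "e \<in> Q" using U by auto
      have "[U - e]\<^bsup>2\<^esup> \<subseteq> [U]\<^bsup>2\<^esup>" by (auto simp: nsets_def)
      then have "U - e \<in> ?K w" using U 3 e \<open>finite e\<close> by (auto simp: card_Diff_subset)
      moreover have "U = e \<union> (U - e)" using e by auto
      ultimately show "U \<in> (\<lambda>(e, W). e \<union> W) ` (Q \<times> ?K w)" using \<open>e \<in> Q\<close>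
        by (metis (no_types, lifting) SigmaI case_prod_conv image_eqI)
    qed
    then have "card (?K u) \<le> card (Q \<times> ?K w)"
      using assms(2) fin by (intro surj_card_le) auto
    also have "\<dots> \<le> card Q * (card Q ^ (w div 2) * card V ^ (w mod 2))"
      unfolding card_cartesian_product using less[of w] 3 by (intro mult_left_mono) auto
    finally show ?thesis using 3 by simp
  qed
qed

section \<open>Maximum matchings of queried pairs in a clique\<close>

definition matching :: "'a set set \<Rightarrow> bool" where
  "matching M \<longleftrightarrow> (\<forall>e\<in>M. card e = 2) \<and> disjoint M"

definition cross_pairs :: "'a set set \<Rightarrow> 'a set \<Rightarrow> 'a set \<Rightarrow> 'a set set" where
  "cross_pairs Q S U = {{x, y} | x y. x \<in> S \<and> y \<in> U \<and> {x, y} \<in> Q}"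

lemma card_Union_matching:
  assumes "matching M"
  shows "card (\<Union>M) = 2 * card M"
proof -
  have "card (\<Union>M) = sum card M"
    using assms unfolding matching_def
    by (intro card_Union_disjoint) (auto simp: disjoint_def pairwise_def disjnt_def card_2_iff)
  then show ?thesis using assms by (simp add: matching_def)
qed

lemma matching_insert:
  assumes "matching M" "card e = 2" "e \<inter> \<Union>M = {}"
  shows "matching (insert e M)"
  using assms by (auto simp: matching_def disjoint_def)

text \<open>The count is done per matching pair \<open>{x, y}\<close>. There is no augmenting path
  of length three, so either one of \<open>x\<close>, \<open>y\<close> has no
  \<open>Q\<close>-neighbour in \<open>U\<close>, or both have the same single one.\<close>

lemma cross_pairs_maximum_matching:
  fixes C :: "'a set"
  assumes C: "finite C" and M: "M \<subseteq> Q \<inter> [C]\<^bsup>2\<^esup>" "matching M"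
    and max: "\<And>N. N \<subseteq> Q \<inter> [C]\<^bsup>2\<^esup> \<Longrightarrow> matching N \<Longrightarrow> card N \<le> card M"
    and U: "U = C - \<Union>M"
  shows "card (cross_pairs Q (\<Union>M) U) \<le> card M * (card U + 1)"
proof -
  have finM: "finite M" using M(1) C finite_imp_finite_nsets[of C 2] finite_subset by blast
  have finU: "finite U" using C U by auto
  have edge: "card (cross_pairs Q e U) \<le> card U + 1" if e: "e \<in> M" for e
  proof -
    obtain x y where xy: "e = {x, y}" "x \<noteq> y"
      using e M(2) unfolding matching_def by (meson card_2_iff)
    have xyC: "x \<in> C" "y \<in> C" using e M(1) xy by (auto simp: nsets_def)
    have key: "u = v" if "u \<in> U" "v \<in> U" "{x, u} \<in> Q" "{y, v} \<in> Q" for u v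
    proof (rule ccontr)
      assume "u \<noteq> v"
      \<comment> \<open>Augmenting along the path \<open>u\<close>, \<open>x\<close>,
        \<open>y\<close>, \<open>v\<close>: the pair \<open>e\<close> is traded for two
        pairs.\<close>
      let ?N = "insert {x, u} (insert {y, v} (M - {e}))"
      have notM: "u \<notin> \<Union>M" "v \<notin> \<Union>M" "u \<in> C" "v \<in> C" using that U by auto
      have nexy: "x \<noteq> u" "x \<noteq> v" "y \<noteq> u" "y \<noteq> v" using notM e xy(1) by blast+
      have sub: "?N \<subseteq> Q \<inter> [C]\<^bsup>2\<^esup>"
        using M(1) that notM xyC nexy by (auto simp: nsets_def)
      have dis: "f \<inter> {x, y, u, v} = {}" if "f \<in> M - {e}" for f
      proof -
        have "f \<inter> e = {}" using that e M(2) unfolding matching_def disjoint_def by auto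
        then show ?thesis using xy notM that by auto
      qed
      have "matching (M - {e})" using M(2) unfolding matching_def disjoint_def by auto
      moreover have "{y, v} \<inter> \<Union>(M - {e}) = {}" using dis by blast
      moreover have "card {y, v} = 2" using nexy by simp
      ultimately have "matching (insert {y, v} (M - {e}))" by (intro matching_insert)
      moreover have "{x, u} \<inter> \<Union>(insert {y, v} (M - {e})) = {}"
      proof -
        have "{x, u} \<inter> {y, v} = {}" using nexy \<open>u \<noteq> v\<close> \<open>x \<noteq> y\<close> by simp
        moreover have "{x, u} \<inter> \<Union>(M - {e}) = {}" using dis by blast
        ultimately show ?thesis by (simp only: Union_insert Int_Un_distrib Un_empty)
      qed
      moreover have "card {x, u} = 2" using nexy by simp
      ultimately have "matching ?N" by (metis matching_insert)
      moreover have "card ?N = Suc (card M)"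
      proof -
        have "{y, v} \<notin> M - {e}" "{x, u} \<notin> M - {e}" using notM by blast+
        moreover have "{x, u} \<noteq> {y, v}" using nexy \<open>x \<noteq> y\<close> by (auto simp: doubleton_eq_iff)
        ultimately show ?thesis using finM e card_Suc_Diff1[OF finM e] by simp
      qed
      ultimately show False using max[OF sub] by simp
    qed
    let ?X = "{u \<in> U. {x, u} \<in> Q}" and ?Y = "{u \<in> U. {y, u} \<in> Q}"
    have "cross_pairs Q e U = (\<lambda>u. {x, u}) ` ?X \<union> (\<lambda>u. {y, u}) ` ?Y"
      unfolding cross_pairs_def xy(1) by blast
    then have "card (cross_pairs Q e U) \<le> card ((\<lambda>u. {x, u}) ` ?X) + card ((\<lambda>u. {y, u}) ` ?Y)"
      by (simp add: card_Un_le)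
    also have "\<dots> \<le> card ?X + card ?Y" using finU by (intro add_mono card_image_le) auto
    \<comment> \<open>If both neighbourhoods are nonempty, each is a singleton and the total is at
      most 2. The extra 1 is needed for this case when \<open>U\<close> has one vertex.\<close>
    also have "\<dots> \<le> card U + 1"
    proof (cases "?X = {} \<or> ?Y = {}")
      case True
      have "card ?X \<le> card U" "card ?Y \<le> card U" using finU by (auto intro: card_mono)
      moreover have "card ?X = 0 \<or> card ?Y = 0" using True by (metis (no_types, lifting) card.empty)
      ultimately show ?thesis by linarith
    next
      case False
      then obtain u v where uv: "u \<in> ?X" "v \<in> ?Y" by blast
      have "?X \<subseteq> {v}" "?Y \<subseteq> {u}" using uv key by blast+
      then have "card ?X \<le> 1" "card ?Y \<le> 1" using card_mono[of "{v}" ?X] card_mono[of "{u}" ?Y] by auto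
      moreover have "card U \<ge> 1" using uv finU by (auto simp: Suc_le_eq card_gt_0_iff)
      ultimately show ?thesis by linarith
    qed
    finally show ?thesis .
  qed
  have "cross_pairs Q (\<Union>M) U = (\<Union>e\<in>M. cross_pairs Q e U)"
    unfolding cross_pairs_def by blast
  then have "card (cross_pairs Q (\<Union>M) U) \<le> (\<Sum>e\<in>M. card (cross_pairs Q e U))"
    using card_UN_le[OF finM] by metis
  also have "\<dots> \<le> (\<Sum>e\<in>M. card U + 1)" using edge by (rule sum_mono)
  finally show ?thesis by simp
qed

text \<open>Besides the cross-pair bound, maximality forbids a \<open>Q\<close>-pair inside the
  uncovered part, since it could be added to \<open>M\<close>. The counting below relies on just
  these two consequences of maximality.\<close>

lemma obtain_maximum_matching:
  assumes C: "finite C"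
  obtains M where "M \<subseteq> Q \<inter> [C]\<^bsup>2\<^esup>" "matching M" "[C - \<Union>M]\<^bsup>2\<^esup> \<inter> Q = {}"
    "card (cross_pairs Q (\<Union>M) (C - \<Union>M)) \<le> card M * (card (C - \<Union>M) + 1)"
proof -
  let ?\<M> = "{N. N \<subseteq> Q \<inter> [C]\<^bsup>2\<^esup> \<and> matching N}"
  have finQ: "finite (Q \<inter> [C]\<^bsup>2\<^esup>)" using C finite_imp_finite_nsets[of C 2] by blast
  then have fin: "finite ?\<M>" by (rule finite_subset[rotated, OF finite_Pow_iff[THEN iffD2]]) blast
  have ne: "{} \<in> ?\<M>" by (auto simp: matching_def)
  have "Max (card ` ?\<M>) \<in> card ` ?\<M>" using fin ne by (intro Max_in) blast+
  then obtain M where "M \<in> ?\<M>" "card M = Max (card ` ?\<M>)" by (metis (no_types, lifting) imageE)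
  then have M: "M \<in> ?\<M>" "\<And>N. N \<in> ?\<M> \<Longrightarrow> card N \<le> card M" using fin by simp_all
  have "[C - \<Union>M]\<^bsup>2\<^esup> \<inter> Q = {}"
  proof (rule ccontr)
    assume "[C - \<Union>M]\<^bsup>2\<^esup> \<inter> Q \<noteq> {}"
    then obtain e where e: "e \<in> Q" "e \<subseteq> C - \<Union>M" "finite e" "card e = 2" by (auto simp: nsets_def)
    then have "insert e M \<in> ?\<M>"
      using M(1) by (auto simp: nsets_def intro!: matching_insert)
    moreover have "e \<notin> M" using e by (auto simp: card_2_iff)
    moreover have "finite M" using M(1) finQ finite_subset by blast
    ultimately show False using M(2)[of "insert e M"] by simp
  qed
  then show ?thesis
    using that[of M] M cross_pairs_maximum_matching[OF C, of M Q "C - \<Union>M"] by auto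
qed

section \<open>The two union bounds for a fixed matching\<close>

text \<open>Sorts the pairs of a clique by how they are paid for: pairs outside \<open>Q\<close>
  after the first round is exposed, \<open>Q\<close>-pairs inside \<open>S\<close> together with the
  first round, and cross pairs not at all.\<close>

lemma nsets_2_Un_subset:
  assumes "[U]\<^bsup>2\<^esup> \<inter> Q = {}"
  shows "[S \<union> U]\<^bsup>2\<^esup> \<subseteq> ([S \<union> U]\<^bsup>2\<^esup> - Q) \<union> (Q \<inter> [S]\<^bsup>2\<^esup>) \<union> cross_pairs Q S U"
proof
  fix e assume e: "e \<in> [S \<union> U]\<^bsup>2\<^esup>"
  then obtain x y where xy: "e = {x, y}" "x \<noteq> y" "x \<in> S \<union> U" "y \<in> S \<union> U"
    by (metis nsets2_E)
  show "e \<in> ([S \<union> U]\<^bsup>2\<^esup> - Q) \<union> (Q \<inter> [S]\<^bsup>2\<^esup>) \<union> cross_pairs Q S U"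
  proof (cases "e \<in> Q")
    case True
    then have "\<not> (x \<in> U \<and> y \<in> U)" 
      using assms True xy(1,2) doubleton_in_nsets_2[of x y U] by (metis IntI empty_iff)
    moreover have "e \<in> cross_pairs Q S U" if "x \<in> S" "y \<in> U"
      using that True xy(1) unfolding cross_pairs_def by blast
    moreover have "e \<in> cross_pairs Q S U" if "y \<in> S" "x \<in> U"
    proof -
      have "e = {y, x}" using xy(1) by (simp add: insert_commute)
      then show ?thesis using that True unfolding cross_pairs_def by blast
    qed
    moreover have "e \<in> Q \<inter> [S]\<^bsup>2\<^esup>" if "x \<in> S" "y \<in> S" using that True xy by auto
    ultimately show ?thesis using xy by blast
  qed (use e in auto)
qed

text \<open>First union bound. Sum over the first-round answers \<open>B\<close>, then over the sets
  \<open>U\<close> that the second round \<open>R B\<close> can span, then over the rest of the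
  graph. As \<open>U\<close> is chosen with \<open>B\<close> already known, the
  \<open>Q\<close>-pairs between \<open>\<Union>M\<close> and \<open>U\<close> cannot be charged;
  they cost the factor \<open>2 ^ (card M * (u + 1))\<close>.\<close>

lemma card_adaptive_extensions_le:
  fixes M :: "'a set set"
  assumes V: "finite V" and Q: "Q \<subseteq> [V]\<^bsup>2\<^esup>" and M: "M \<subseteq> Q" "matching M"
    and R: "\<And>B. B \<subseteq> Q \<Longrightarrow> R B \<subseteq> [V]\<^bsup>2\<^esup>" "\<And>B. B \<subseteq> Q \<Longrightarrow> card (R B) \<le> q"
  shows "card {E \<in> Pow ([V]\<^bsup>2\<^esup>). \<exists>U\<subseteq>V. card U = u \<and> U \<inter> \<Union>M = {} \<and> [U]\<^bsup>2\<^esup> \<inter> Q = {} \<and>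
            [U]\<^bsup>2\<^esup> \<subseteq> R (E \<inter> Q) \<and> card (cross_pairs Q (\<Union>M) U) \<le> card M * (u + 1) \<and>
            [\<Union>M \<union> U]\<^bsup>2\<^esup> \<subseteq> E} * 2 ^ ((2 * card M + u) choose 2)
         \<le> q ^ (u div 2) * card V ^ (u mod 2) * 2 ^ (card M * (u + 1)) * 2 ^ card ([V]\<^bsup>2\<^esup>)"
    (is "card ?X * 2 ^ ?K \<le> ?N * 2 ^ ?c * 2 ^ card ?P")
proof -
  let ?S = "\<Union>M"
  \<comment> \<open>\<open>A\<close> depends on \<open>M\<close> alone and not on \<open>U\<close>,
    so it can be charged when the answers \<open>B\<close> are counted.\<close>
  define A where "A = Q \<inter> [?S]\<^bsup>2\<^esup>"
  \<comment> \<open>The vacuous \<open>B \<inter> {} = {}\<close> gives the set the shape of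
    \<open>card_extensions_le\<close> with no exposed pairs.\<close>
  define \<B> where "\<B> = {B \<in> Pow Q. B \<inter> {} = {} \<and> A \<subseteq> B}"
  define \<U> where "\<U> B = {U. U \<subseteq> V \<and> card U = u \<and> U \<inter> ?S = {} \<and> [U]\<^bsup>2\<^esup> \<inter> Q = {} \<and>
      [U]\<^bsup>2\<^esup> \<subseteq> R B \<and> card (cross_pairs Q ?S U) \<le> ?c}" for B
  define Y where "Y B U = {E \<in> Pow ?P. E \<inter> Q = B \<and> [?S \<union> U]\<^bsup>2\<^esup> - Q \<subseteq> E}" for B U
  have finP: "finite ?P" using V by (rule finite_imp_finite_nsets)
  have finQ: "finite Q" using finP Q finite_subset by blast
  have SV: "?S \<subseteq> V" using M(1) Q by (auto simp: nsets_def)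
  have cS: "card ?S = 2 * card M" by (rule card_Union_matching[OF M(2)])
  have finS: "finite ?S" using SV V finite_subset by blast
  have fin\<B>: "finite \<B>" unfolding \<B>_def using finQ by simp
  have fin\<U>: "finite (\<U> B)" for B unfolding \<U>_def using V by simp
  have c\<B>: "card \<B> * 2 ^ card A \<le> 2 ^ card Q"
    using card_extensions_le[of Q "{}" A "{}"] finQ unfolding \<B>_def by (simp add: A_def)
  have c\<U>: "card (\<U> B) \<le> ?N" if "B \<in> \<B>" for B
  proof -
    have B: "B \<subseteq> Q" using that by (auto simp: \<B>_def)
    have finR: "finite (R B)" using R(1)[OF B] finP finite_subset by blast
    have "card (\<U> B) \<le> card {U. U \<subseteq> V \<and> card U = u \<and> [U]\<^bsup>2\<^esup> \<subseteq> R B}"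
      unfolding \<U>_def using V by (intro card_mono) auto
    also have "\<dots> \<le> card (R B) ^ (u div 2) * card V ^ (u mod 2)"
      by (rule card_nsets_2_subset_le[OF V finR])
    also have "\<dots> \<le> ?N" using R(2)[OF B] by (intro mult_right_mono power_mono) auto
    finally show ?thesis .
  qed
  have cY: "card (Y B U) * (2 ^ card Q * 2 ^ ?K) \<le> 2 ^ card ?P * (2 ^ card A * 2 ^ ?c)"
    if "U \<in> \<U> B" for B U
  proof -
    let ?F = "[?S \<union> U]\<^bsup>2\<^esup> - Q"
    have U: "U \<subseteq> V" "card U = u" "U \<inter> ?S = {}" "[U]\<^bsup>2\<^esup> \<inter> Q = {}" "card (cross_pairs Q ?S U) \<le> ?c"
      using that by (auto simp: \<U>_def)
    have finU: "finite U" using U(1) V finite_subset by blast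
    have "?K = card ([?S \<union> U]\<^bsup>2\<^esup>)"
      using U cS finU finS by (simp add: card_Un_disjoint Int_commute)
    also have "\<dots> \<le> card (?F \<union> A \<union> cross_pairs Q ?S U)"
    proof (rule card_mono)
      have "finite ?F" using finite_imp_finite_nsets[of "?S \<union> U" 2] finS finU by blast
      moreover have "cross_pairs Q ?S U \<subseteq> Q" unfolding cross_pairs_def by blast
      ultimately show "finite (?F \<union> A \<union> cross_pairs Q ?S U)"
        using finQ by (auto simp: A_def intro: finite_subset)
    qed (use nsets_2_Un_subset[OF U(4), of ?S] A_def in blast)
    also have "\<dots> \<le> card ?F + card A + card (cross_pairs Q ?S U)"
      by (meson add_right_mono card_Un_le order_trans)
    finally have K: "?K \<le> card ?F + card A + ?c" using U(5) by linarith
    have "?F \<subseteq> ?P" using SV U(1) nsets_mono[of "?S \<union> U" V 2] by blast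
    then have "card (Y B U) * 2 ^ (card Q + card ?F) \<le> 2 ^ card ?P"
      unfolding Y_def by (intro card_extensions_le finP Q) auto
    then have "card (Y B U) * 2 ^ (card Q + card ?F) * (2 ^ card A * 2 ^ ?c)
        \<le> 2 ^ card ?P * (2 ^ card A * 2 ^ ?c)"
      by (rule mult_right_mono) simp
    moreover have "card (Y B U) * (2 ^ card Q * 2 ^ ?K)
        \<le> card (Y B U) * (2 ^ card Q * 2 ^ (card ?F + card A + ?c))"
      using K by (intro mult_left_mono power_increasing) auto
    moreover have "card (Y B U) * (2 ^ card Q * 2 ^ (card ?F + card A + ?c))
        = card (Y B U) * 2 ^ (card Q + card ?F) * (2 ^ card A * 2 ^ ?c)"
      by (simp only: power_add mult_ac)
    ultimately show ?thesis by linarith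
  qed
  have "?X \<subseteq> (\<Union>B\<in>\<B>. \<Union>U\<in>\<U> B. Y B U)"
  proof
    fix E assume "E \<in> ?X"
    then obtain U where U: "E \<subseteq> ?P" "U \<subseteq> V" "card U = u" "U \<inter> ?S = {}" "[U]\<^bsup>2\<^esup> \<inter> Q = {}"
      "[U]\<^bsup>2\<^esup> \<subseteq> R (E \<inter> Q)" "card (cross_pairs Q ?S U) \<le> ?c" "[?S \<union> U]\<^bsup>2\<^esup> \<subseteq> E" by blast
    have "[?S]\<^bsup>2\<^esup> \<subseteq> E" using U(8) nsets_mono[of ?S "?S \<union> U" 2] by blast
    then have "E \<inter> Q \<in> \<B>" by (auto simp: \<B>_def A_def)
    moreover have "U \<in> \<U> (E \<inter> Q)" using U by (simp add: \<U>_def)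
    moreover have "E \<in> Y (E \<inter> Q) U" using U by (auto simp: Y_def)
    ultimately show "E \<in> (\<Union>B\<in>\<B>. \<Union>U\<in>\<U> B. Y B U)" by blast
  qed
  moreover have "finite (\<Union>B\<in>\<B>. \<Union>U\<in>\<U> B. Y B U)"
    using fin\<B> fin\<U> finP by (auto simp: Y_def)
  ultimately have "card ?X \<le> card (\<Union>B\<in>\<B>. \<Union>U\<in>\<U> B. Y B U)" by (rule card_mono[rotated])
  also have "\<dots> \<le> (\<Sum>B\<in>\<B>. \<Sum>U\<in>\<U> B. card (Y B U))"
    by (rule order_trans[OF card_UN_le[OF fin\<B>] sum_mono[OF card_UN_le[OF fin\<U>]]])
  \<comment> \<open>The factor \<open>2 ^ card Q\<close> stands for the exposed first round. It is
    produced again by the number of admissible \<open>B\<close> and cancelled at the end.\<close>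
  finally have "card ?X * (2 ^ card Q * 2 ^ ?K)
      \<le> (\<Sum>B\<in>\<B>. \<Sum>U\<in>\<U> B. card (Y B U)) * (2 ^ card Q * 2 ^ ?K)"
    by (rule mult_right_mono) simp
  also have "\<dots> = (\<Sum>B\<in>\<B>. \<Sum>U\<in>\<U> B. card (Y B U) * (2 ^ card Q * 2 ^ ?K))"
    by (simp add: sum_distrib_right)
  also have "\<dots> \<le> (\<Sum>B\<in>\<B>. \<Sum>U\<in>\<U> B. 2 ^ card ?P * (2 ^ card A * 2 ^ ?c))"
    by (intro sum_mono cY)
  also have "\<dots> = (\<Sum>B\<in>\<B>. card (\<U> B)) * (2 ^ card ?P * (2 ^ card A * 2 ^ ?c))"
    by (simp add: sum_distrib_right)
  also have "\<dots> \<le> (card \<B> * ?N) * (2 ^ card ?P * (2 ^ card A * 2 ^ ?c))"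
    using sum_bounded_above[of \<B> "\<lambda>B. card (\<U> B)" ?N] c\<U> by (intro mult_right_mono) auto
  also have "\<dots> = (card \<B> * 2 ^ card A) * (?N * 2 ^ ?c * 2 ^ card ?P)" by (simp add: mult_ac)
  also have "\<dots> \<le> 2 ^ card Q * (?N * 2 ^ ?c * 2 ^ card ?P)"
    using c\<B> by (rule mult_right_mono) simp
  finally have "2 ^ card Q * (card ?X * 2 ^ ?K) \<le> 2 ^ card Q * (?N * 2 ^ ?c * 2 ^ card ?P)"
    by (simp add: mult_ac)
  then show ?thesis by simp
qed

lemma choose_le_power: "n choose r \<le> n ^ r"
  by (cases "r \<le> n") (simp_all add: binomial_le_pow binomial_eq_0)

text \<open>Second union bound. The queries are ignored and \<open>U\<close> ranges over all vertex
  sets of its size; this choice does not depend on \<open>E\<close>, so every pair of the clique can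
  be charged.\<close>

lemma card_clique_extensions_le:
  assumes V: "finite V" and S: "S \<subseteq> V"
  shows "card {E \<in> Pow ([V]\<^bsup>2\<^esup>). \<exists>U\<subseteq>V. card U = u \<and> U \<inter> S = {} \<and> [S \<union> U]\<^bsup>2\<^esup> \<subseteq> E}
           * 2 ^ ((card S + u) choose 2) \<le> card V ^ u * 2 ^ card ([V]\<^bsup>2\<^esup>)"
    (is "card ?X * 2 ^ ?K \<le> _ * 2 ^ card ?P")
proof -
  define \<U> where "\<U> = {U. U \<subseteq> V \<and> card U = u \<and> U \<inter> S = {}}"
  define Y where "Y U = {E \<in> Pow ?P. E \<inter> {} = {} \<and> [S \<union> U]\<^bsup>2\<^esup> \<subseteq> E}" for U
  have finP: "finite ?P" using V by (rule finite_imp_finite_nsets)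
  have fin\<U>: "finite \<U>" unfolding \<U>_def using V by simp
  have "card \<U> \<le> card {U. U \<subseteq> V \<and> card U = u}"
    unfolding \<U>_def using V by (intro card_mono) auto
  also have "\<dots> = card V choose u" by (rule n_subsets[OF V])
  also have "\<dots> \<le> card V ^ u" by (rule choose_le_power)
  finally have c\<U>: "card \<U> \<le> card V ^ u" .
  have cY: "card (Y U) * 2 ^ ?K \<le> 2 ^ card ?P" if "U \<in> \<U>" for U
  proof -
    have "U \<subseteq> V" "card U = u" "U \<inter> S = {}" using that by (auto simp: \<U>_def)
    moreover have "finite U" "finite S" using \<open>U \<subseteq> V\<close> S V finite_subset by blast+
    ultimately have "?K = card ([S \<union> U]\<^bsup>2\<^esup>)" by (simp add: card_Un_disjoint Int_commute)
    then show ?thesis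
      using card_extensions_le[OF finP, of "{}" "[S \<union> U]\<^bsup>2\<^esup>" "{}"]
        nsets_mono[of "S \<union> U" V 2] S \<open>U \<subseteq> V\<close>
      unfolding Y_def by simp
  qed
  have "?X \<subseteq> (\<Union>U\<in>\<U>. Y U)" by (auto simp: \<U>_def Y_def)
  moreover have "finite (\<Union>U\<in>\<U>. Y U)" using fin\<U> finP by (auto simp: Y_def)
  ultimately have "card ?X \<le> card (\<Union>U\<in>\<U>. Y U)" by (rule card_mono[rotated])
  also have "\<dots> \<le> (\<Sum>U\<in>\<U>. card (Y U))" by (rule card_UN_le[OF fin\<U>])
  finally have "card ?X * 2 ^ ?K \<le> (\<Sum>U\<in>\<U>. card (Y U)) * 2 ^ ?K" by (rule mult_right_mono) simp
  also have "\<dots> = (\<Sum>U\<in>\<U>. card (Y U) * 2 ^ ?K)" by (rule sum_distrib_right)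
  also have "\<dots> \<le> (\<Sum>U\<in>\<U>. 2 ^ card ?P)" by (rule sum_mono[OF cY])
  also have "\<dots> \<le> card V ^ u * 2 ^ card ?P" using c\<U> by simp
  finally show ?thesis .
qed

section \<open>Union bound over all matchings\<close>

text \<open>Here \<open>m\<close> is the size of a maximum matching of first-round pairs in the
  clique and \<open>k - 2 * m\<close> the number of uncovered vertices. Each of the at most
  \<open>card Q ^ m\<close> matchings gets the better of the two union bounds.\<close>

lemma card_two_round_cliques_le:
  fixes V :: "'a set"
  assumes V: "finite V" and Q: "Q \<subseteq> [V]\<^bsup>2\<^esup>"
    and R: "\<And>B. B \<subseteq> Q \<Longrightarrow> R B \<subseteq> [V]\<^bsup>2\<^esup>" "\<And>B. B \<subseteq> Q \<Longrightarrow> card (R B) \<le> q"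
  shows "card {E \<in> Pow ([V]\<^bsup>2\<^esup>). \<exists>C\<subseteq>V. card C = k \<and> [C]\<^bsup>2\<^esup> \<subseteq> (Q \<union> R (E \<inter> Q)) \<inter> E} * 2 ^ (k choose 2)
    \<le> (\<Sum>m\<le>k div 2. card Q ^ m * min (q ^ ((k - 2 * m) div 2) * card V ^ ((k - 2 * m) mod 2)
          * 2 ^ (m * (k - 2 * m + 1))) (card V ^ (k - 2 * m))) * 2 ^ card ([V]\<^bsup>2\<^esup>)"
    (is "card ?W * 2 ^ ?K \<le> (\<Sum>m\<le>_. _ * min (?a m) (?b m)) * 2 ^ card ?P")
proof -
  define \<M> where "\<M> m = {M. M \<subseteq> Q \<and> card M = m \<and> matching M}" for m
  define X where "X M u = {E \<in> Pow ?P. \<exists>U\<subseteq>V. card U = u \<and> U \<inter> \<Union>M = {} \<and> [U]\<^bsup>2\<^esup> \<inter> Q = {} \<and>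
      [U]\<^bsup>2\<^esup> \<subseteq> R (E \<inter> Q) \<and> card (cross_pairs Q (\<Union>M) U) \<le> card M * (u + 1) \<and>
      [\<Union>M \<union> U]\<^bsup>2\<^esup> \<subseteq> E}" for M u
  have finP: "finite ?P" using V by (rule finite_imp_finite_nsets)
  have finQ: "finite Q" using finP Q finite_subset by blast
  have fin\<M>: "finite (\<M> m)" for m unfolding \<M>_def using finQ by simp
  have finX: "finite (X M u)" for M u unfolding X_def using finP by simp
  have c\<M>: "card (\<M> m) \<le> card Q ^ m" for m
  proof -
    have "card (\<M> m) \<le> card {M. M \<subseteq> Q \<and> card M = m}"
      unfolding \<M>_def using finQ by (intro card_mono) auto
    then show ?thesis using n_subsets[OF finQ, of m] choose_le_power[of "card Q" m] by linarith
  qed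
  \<comment> \<open>Both bounds apply to the same set of graphs and carry the same factor
    \<open>2 ^ ?K\<close>, so their minimum may be taken matching by matching.\<close>
  have cX: "card (X M (k - 2 * m)) * 2 ^ ?K \<le> min (?a m) (?b m) * 2 ^ card ?P"
    if m: "m \<le> k div 2" and M: "M \<in> \<M> m" for m M
  proof -
    have MM: "M \<subseteq> Q" "card M = m" "matching M" using M by (auto simp: \<M>_def)
    have K: "2 * m + (k - 2 * m) = k" using m by linarith
    have S: "\<Union>M \<subseteq> V" using MM(1) Q by (auto simp: nsets_def)
    have "card (X M (k - 2 * m)) * 2 ^ ?K \<le> ?a m * 2 ^ card ?P"
      using card_adaptive_extensions_le[OF V Q MM(1) MM(3) R, where u = "k - 2 * m"]
      unfolding X_def MM(2) K by simp
    moreover have "card (X M (k - 2 * m)) * 2 ^ ?K \<le> ?b m * 2 ^ card ?P"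
    proof -
      have "card (X M (k - 2 * m)) \<le> card {E \<in> Pow ?P. \<exists>U\<subseteq>V. card U = k - 2 * m \<and>
          U \<inter> \<Union>M = {} \<and> [\<Union>M \<union> U]\<^bsup>2\<^esup> \<subseteq> E}"
        unfolding X_def using finP by (intro card_mono) auto
      then have "card (X M (k - 2 * m)) * 2 ^ ?K \<le> card {E \<in> Pow ?P. \<exists>U\<subseteq>V. card U = k - 2 * m \<and>
          U \<inter> \<Union>M = {} \<and> [\<Union>M \<union> U]\<^bsup>2\<^esup> \<subseteq> E} * 2 ^ ?K" by (rule mult_right_mono) simp
      also have "\<dots> \<le> ?b m * 2 ^ card ?P"
        using card_clique_extensions_le[OF V S, of "k - 2 * m"]
        unfolding card_Union_matching[OF MM(3)] MM(2) K .
      finally show ?thesis .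
    qed
    ultimately show ?thesis by (simp add: min_def)
  qed
  have "?W \<subseteq> (\<Union>m\<in>{..k div 2}. \<Union>M\<in>\<M> m. X M (k - 2 * m))"
  proof
    fix E assume "E \<in> ?W"
    then obtain C where C: "E \<subseteq> ?P" "C \<subseteq> V" "card C = k" "[C]\<^bsup>2\<^esup> \<subseteq> Q \<union> R (E \<inter> Q)" "[C]\<^bsup>2\<^esup> \<subseteq> E"
      by blast
    have finC: "finite C" using C(2) V finite_subset by blast
    obtain M where M: "M \<subseteq> Q \<inter> [C]\<^bsup>2\<^esup>" "matching M" "[C - \<Union>M]\<^bsup>2\<^esup> \<inter> Q = {}"
      "card (cross_pairs Q (\<Union>M) (C - \<Union>M)) \<le> card M * (card (C - \<Union>M) + 1)"
      using obtain_maximum_matching[OF finC] .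
    have SC: "\<Union>M \<subseteq> C" using M(1) by (auto simp: nsets_def)
    then have cle: "2 * card M \<le> k"
      using card_mono[OF finC SC] card_Union_matching[OF M(2)] C(3) by simp
    have cU: "card (C - \<Union>M) = k - 2 * card M"
      using SC finC card_Union_matching[OF M(2)] C(3) by (simp add: card_Diff_subset finite_subset)
    have UC: "[C - \<Union>M]\<^bsup>2\<^esup> \<subseteq> [C]\<^bsup>2\<^esup>" by (rule nsets_mono) blast
    have "E \<in> X M (k - 2 * card M)"
      unfolding X_def
    proof (intro CollectI conjI exI[of _ "C - \<Union>M"])
      \<comment> \<open>The uncovered pairs avoid \<open>Q\<close>, hence must come from the second
        round.\<close>
      show "[C - \<Union>M]\<^bsup>2\<^esup> \<subseteq> R (E \<inter> Q)" using UC C(4) M(3) by blast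
      show "[\<Union>M \<union> (C - \<Union>M)]\<^bsup>2\<^esup> \<subseteq> E" using C(5) SC by (simp add: Un_absorb1)
    qed (use C M cU in auto)
    moreover have "M \<in> \<M> (card M)" using M by (auto simp: \<M>_def)
    moreover have "card M \<in> {..k div 2}" using cle by simp
    ultimately show "E \<in> (\<Union>m\<in>{..k div 2}. \<Union>M\<in>\<M> m. X M (k - 2 * m))" by blast
  qed
  moreover have "finite (\<Union>m\<in>{..k div 2}. \<Union>M\<in>\<M> m. X M (k - 2 * m))"
    using fin\<M> finX by auto
  ultimately have "card ?W \<le> card (\<Union>m\<in>{..k div 2}. \<Union>M\<in>\<M> m. X M (k - 2 * m))"
    by (rule card_mono[rotated])
  also have "\<dots> \<le> (\<Sum>m\<le>k div 2. \<Sum>M\<in>\<M> m. card (X M (k - 2 * m)))"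
    by (rule order_trans[OF card_UN_le[OF finite_atMost] sum_mono[OF card_UN_le[OF fin\<M>]]])
  finally have "card ?W * 2 ^ ?K \<le> (\<Sum>m\<le>k div 2. \<Sum>M\<in>\<M> m. card (X M (k - 2 * m))) * 2 ^ ?K"
    by (rule mult_right_mono) simp
  also have "\<dots> = (\<Sum>m\<le>k div 2. \<Sum>M\<in>\<M> m. card (X M (k - 2 * m)) * 2 ^ ?K)"
    by (simp add: sum_distrib_right)
  also have "\<dots> \<le> (\<Sum>m\<le>k div 2. \<Sum>M\<in>\<M> m. min (?a m) (?b m) * 2 ^ card ?P)"
    by (intro sum_mono cX) auto
  also have "\<dots> = (\<Sum>m\<le>k div 2. card (\<M> m) * min (?a m) (?b m)) * 2 ^ card ?P"
    by (simp only: sum_distrib_right sum_constant of_nat_id mult.assoc)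
  also have "\<dots> \<le> (\<Sum>m\<le>k div 2. card Q ^ m * min (?a m) (?b m)) * 2 ^ card ?P"
    using c\<M> by (intro mult_right_mono sum_mono) auto
  finally show ?thesis .
qed

section \<open>From counting to exponents\<close>

lemma random_graph_half: "random_graph n (1/2) = pmf_of_set (Pow ([{..<n}]\<^bsup>2\<^esup>))"
  unfolding random_graph_def
  by (rule pmf_of_set_Pow_conv_bernoulli) (simp add: finite_imp_finite_nsets)

text \<open>Quadratic part of the base-2 exponent of the first union bound, with
  \<open>x = 2 * m\<close>: choice of the matching, choice of \<open>U\<close>, uncharged cross
  pairs, all pairs of the clique. The rate \<open>\<delta>/2 * L\<close> on the right is minus the
  slope in \<open>k\<close> at \<open>k = (1 + \<delta>/2) * L\<close> and
  \<open>x = (2 - \<delta>) * L\<close>.\<close>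

lemma few_matched_exponent_le:
  fixes \<delta> L k x :: real
  assumes "6/5 < \<delta>" "\<delta> < 2" "0 < L" "(1 + \<delta>/2) * L \<le> k" "x \<le> (2 - \<delta>) * L"
  shows "L * (3/2 - \<delta>/4) * x / 2 + L * \<delta> * (k - x) / 2 + x * (k - x) / 2 - k\<^sup>2 / 2
           \<le> - ((k - (1 + \<delta>/2) * L) * (\<delta>/2) * L)"
proof -
  have drop: "g - y / 2 - z / 2 \<le> g" if "0 \<le> y" "0 \<le> z" for g y z :: real
    using that by linarith
  define k0 where "k0 = (1 + \<delta>/2) * L"
  \<comment> \<open>At \<open>k = k0\<close> the left-hand side is a concave quadratic in \<open>x\<close> with roots \<open>(2 - \<delta>) L\<close> and
    \<open>(1/2 + \<delta>/4) L\<close>; the former is the smaller one because \<open>\<delta> > 6/5\<close>.\<close>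
  have "x \<le> (1/2 + \<delta>/4) * L"
  proof -
    have "(2 - \<delta>) * L \<le> (1/2 + \<delta>/4) * L" using assms by (intro mult_right_mono) auto
    then show ?thesis using assms by linarith
  qed
  then have "0 \<le> ((2 - \<delta>) * L - x) * ((1/2 + \<delta>/4) * L - x)"
    using assms by (intro mult_nonneg_nonneg) auto
  moreover have "0 \<le> (k - k0) * (((2 - \<delta>) * L - x) + (k - k0))"
    using assms by (intro mult_nonneg_nonneg add_nonneg_nonneg) (auto simp: k0_def)
  moreover have "L * (3/2 - \<delta>/4) * x / 2 + L * \<delta> * (k - x) / 2 + x * (k - x) / 2 - k\<^sup>2 / 2
      = - ((k - k0) * (\<delta>/2) * L) - ((2 - \<delta>) * L - x) * ((1/2 + \<delta>/4) * L - x) / 2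
        - (k - k0) * (((2 - \<delta>) * L - x) + (k - k0)) / 2"
    unfolding k0_def by (simp add: field_simps power2_eq_square)
  ultimately show ?thesis unfolding k0_def using drop by presburger
qed

text \<open>Second union bound. At \<open>k = (1 + \<delta>/2) * L\<close> the left-hand side is
  linear in \<open>x\<close> with slope \<open>- (1/4 + \<delta>/8) * L\<close> and vanishes at
  \<open>x = (2 - \<delta>) * L\<close>. Its slope in \<open>k\<close> there is the one of the first
  bound, so both cases share one right-hand side.\<close>

lemma many_matched_exponent_le:
  fixes \<delta> L k x :: real
  assumes "0 < \<delta>" "0 < L" "(1 + \<delta>/2) * L \<le> k" "(2 - \<delta>) * L \<le> x"
  shows "L * (3/2 - \<delta>/4) * x / 2 + L * (k - x) - k\<^sup>2 / 2
           \<le> - ((k - (1 + \<delta>/2) * L) * (\<delta>/2) * L)"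
proof -
  have drop: "g - y - z / 2 \<le> g" if "0 \<le> y" "0 \<le> z" for g y z :: real
    using that by linarith
  define k0 where "k0 = (1 + \<delta>/2) * L"
  have "0 \<le> (1/4 + \<delta>/8) * L * (x - (2 - \<delta>) * L)"
    using assms by (intro mult_nonneg_nonneg) auto
  moreover have "0 \<le> (k - k0) * (k - k0)" by simp
  moreover have "L * (3/2 - \<delta>/4) * x / 2 + L * (k - x) - k\<^sup>2 / 2
      = - ((k - k0) * (\<delta>/2) * L) - (1/4 + \<delta>/8) * L * (x - (2 - \<delta>) * L)
        - (k - k0) * (k - k0) / 2"
    unfolding k0_def by (simp add: field_simps power2_eq_square)
  ultimately show ?thesis unfolding k0_def using drop by presburger
qed

text \<open>The term \<open>k * (k - 1) / 2\<close> will cancel against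
  \<open>2 ^ (k choose 2)\<close>, and \<open>k + L\<close> collects the lower-order losses. What
  remains is a negative multiple of \<open>L\<^sup>2\<close> once \<open>a\<close> exceeds
  \<open>1 + \<delta>/2\<close>.\<close>

lemma union_bound_term_le:
  fixes \<delta> a :: real and n k m p q :: nat
  defines "L \<equiv> log 2 (real n)"
  assumes \<delta>: "6/5 < \<delta>" "\<delta> < 2" and n: "2 \<le> n" and a: "1 + \<delta>/2 \<le> a" "a * L \<le> real k"
    and p: "real p \<le> real n powr (3/2 - \<delta>/4)" and q: "real q \<le> real n powr \<delta>"
    and m: "m \<le> k div 2"
  shows "real (p ^ m * min (q ^ ((k - 2 * m) div 2) * n ^ ((k - 2 * m) mod 2)
             * 2 ^ (m * (k - 2 * m + 1))) (n ^ (k - 2 * m)))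
         \<le> 2 powr (real k * (real k - 1) / 2 + real k + L - (a - 1 - \<delta>/2) * (\<delta>/2) * L\<^sup>2)"
proof -
  define u where "u = k - 2 * m"
  define x where "x = 2 * real m"
  have u: "real u = real k - x" using m unfolding u_def x_def by linarith
  have xk: "x \<le> real k" using m unfolding x_def by linarith
  have L: "L > 0" using n unfolding L_def by simp
  have nL: "real n = 2 powr L" using n unfolding L_def by simp
  have pw: "p ^ m \<le> 2 powr (L * (3/2 - \<delta>/4) * x / 2)"
  proof -
    have "real p ^ m \<le> (2 powr (L * (3/2 - \<delta>/4))) ^ m"
      using p unfolding nL powr_powr by (intro power_mono) auto
    also have "\<dots> = 2 powr (L * (3/2 - \<delta>/4) * real m)"
      by (simp add: powr_realpow[symmetric] powr_powr)
    also have "L * (3/2 - \<delta>/4) * real m = L * (3/2 - \<delta>/4) * x / 2" by (simp add: x_def)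
    finally show ?thesis by simp
  qed
  have gap: "(a - 1 - \<delta>/2) * (\<delta>/2) * L\<^sup>2 \<le> (real k - (1 + \<delta>/2) * L) * (\<delta>/2) * L"
  proof -
    have "(a * L - (1 + \<delta>/2) * L) * (\<delta>/2 * L) \<le> (real k - (1 + \<delta>/2) * L) * (\<delta>/2 * L)"
      using a \<delta> L by (intro mult_right_mono) auto
    then show ?thesis by (simp add: power2_eq_square algebra_simps)
  qed
  \<comment> \<open>Of the summand \<open>k\<close>, one half turns \<open>k * (k - 1) / 2\<close>
    into \<open>k\<^sup>2 / 2\<close>; the other half covers \<open>x / 2\<close>, the loss of one
    cross pair per matching pair.\<close>
  have slack: "g + (real k)\<^sup>2 / 2 + x / 2 + r
      \<le> real k * (real k - 1) / 2 + real k + r - (a - 1 - \<delta>/2) * (\<delta>/2) * L\<^sup>2"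
    if "g \<le> - ((real k - (1 + \<delta>/2) * L) * (\<delta>/2) * L)" for g r
  proof -
    have "real k * (real k - 1) / 2 = (real k)\<^sup>2 / 2 - real k / 2"
      by (simp add: power2_eq_square field_simps)
    then show ?thesis using that gap xk by linarith
  qed
  have k0: "(1 + \<delta>/2) * L \<le> real k"
    using mult_right_mono[of "1 + \<delta>/2" a L] a L by linarith
  show ?thesis
  \<comment> \<open>At this threshold both exponents vanish for
    \<open>k = (1 + \<delta>/2) * L\<close>.\<close>
  proof (cases "x \<le> (2 - \<delta>) * L")
    case True
    \<comment> \<open>An odd leftover vertex is chosen among all \<open>n\<close>, which costs at
      most one extra factor \<open>n\<close>, that is \<open>L\<close> in the exponent.\<close>
    have par: "\<delta> * real (u div 2) + real (u mod 2) \<le> \<delta> * real u / 2 + 1"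
    proof -
      have "real u = 2 * real (u div 2) + real (u mod 2)"
        by (metis mult_div_mod_eq of_nat_add of_nat_mult of_nat_numeral)
      then have "\<delta> * real u / 2 = \<delta> * real (u div 2) + \<delta> * real (u mod 2) / 2"
        by (simp add: field_simps)
      moreover have "0 \<le> \<delta> * real (u mod 2)" using \<delta> by simp
      moreover have "real (u mod 2) \<le> 1" by simp
      ultimately show ?thesis by linarith
    qed
    have "real (q ^ (u div 2) * n ^ (u mod 2)) \<le> (2 powr (L * \<delta>)) ^ (u div 2) * (2 powr L) ^ (u mod 2)"
      using q unfolding nL powr_powr of_nat_mult of_nat_power
      by (intro mult_mono power_mono) auto
    also have "\<dots> = 2 powr (L * (\<delta> * real (u div 2) + real (u mod 2)))"
      by (simp add: powr_realpow[symmetric] powr_powr powr_add[symmetric] algebra_simps)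
    also have "\<dots> \<le> 2 powr (L * (\<delta> * real u / 2 + 1))"
      using par L by (intro powr_mono mult_left_mono) auto
    finally have qw: "real (q ^ (u div 2) * n ^ (u mod 2)) \<le> 2 powr (L * (\<delta> * real u / 2 + 1))" .
    have cw: "real (2 ^ (m * (u + 1))) = 2 powr (x * (real k - x + 1) / 2)"
    proof -
      have "x * (real k - x + 1) / 2 = real (m * (u + 1))"
        unfolding u[symmetric] by (simp add: x_def algebra_simps)
      then show ?thesis by (simp only: powr_realpow of_nat_power of_nat_numeral zero_less_numeral)
    qed
    have "real (p ^ m * min (q ^ (u div 2) * n ^ (u mod 2) * 2 ^ (m * (u + 1))) (n ^ u))
        \<le> real (p ^ m) * (real (q ^ (u div 2) * n ^ (u mod 2)) * real (2 ^ (m * (u + 1))))"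
      unfolding of_nat_mult[symmetric] by (intro of_nat_mono mult_left_mono) auto
    also have "\<dots> \<le> 2 powr (L * (3/2 - \<delta>/4) * x / 2) *
        (2 powr (L * (\<delta> * real u / 2 + 1)) * 2 powr (x * (real k - x + 1) / 2))"
      unfolding cw by (intro mult_mono pw qw) auto
    also have "\<dots> = 2 powr (L * (3/2 - \<delta>/4) * x / 2 + (L * (\<delta> * (real k - x) / 2 + 1)
        + x * (real k - x + 1) / 2))"
      by (simp add: powr_add u)
    also have "\<dots> = 2 powr ((L * (3/2 - \<delta>/4) * x / 2 + L * \<delta> * (real k - x) / 2
        + x * (real k - x) / 2 - (real k)\<^sup>2 / 2) + (real k)\<^sup>2 / 2 + x / 2 + L)"
      by (intro arg_cong[where f = "\<lambda>z. 2 powr z"]) (simp add: field_simps)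
    also have "\<dots> \<le> 2 powr (real k * (real k - 1) / 2 + real k + L - (a - 1 - \<delta>/2) * (\<delta>/2) * L\<^sup>2)"
      using slack[OF few_matched_exponent_le[OF \<delta> L k0 True], of L] L by (intro powr_mono) auto
    finally show ?thesis unfolding u_def .
  next
    case False
    have "real (p ^ m * min (q ^ (u div 2) * n ^ (u mod 2) * 2 ^ (m * (u + 1))) (n ^ u))
        \<le> real (p ^ m) * real (n ^ u)"
      unfolding of_nat_mult[symmetric] by (intro of_nat_mono mult_left_mono) auto
    also have "\<dots> \<le> 2 powr (L * (3/2 - \<delta>/4) * x / 2) * real (n ^ u)"
      by (intro mult_right_mono pw) auto
    also have "real (n ^ u) = 2 powr (L * (real k - x))"
      by (simp add: nL powr_realpow[symmetric] powr_powr u)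
    also have "2 powr (L * (3/2 - \<delta>/4) * x / 2) * 2 powr (L * (real k - x))
        = 2 powr ((L * (3/2 - \<delta>/4) * x / 2 + L * (real k - x) - (real k)\<^sup>2 / 2) + (real k)\<^sup>2 / 2)"
      by (simp flip: powr_add)
    also have "\<dots> \<le> 2 powr (real k * (real k - 1) / 2 + real k + L - (a - 1 - \<delta>/2) * (\<delta>/2) * L\<^sup>2)"
      using slack[OF many_matched_exponent_le[OF _ L k0, of x], of L] False \<delta> L
      by (intro powr_mono) (auto simp: x_def)
    finally show ?thesis unfolding u_def .
  qed
qed

section \<open>Two-round algorithms fail above the threshold\<close>

lemma prob_two_round_clique_le:
  fixes \<delta> a :: real and n k :: nat and A :: strategy
  defines "L \<equiv> log 2 (real n)"
  assumes \<delta>: "6/5 < \<delta>" "\<delta> < 2" and n: "2 \<le> n" and a: "1 + \<delta>/2 \<le> a" "a * L \<le> real k"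
    and valid: "\<And>E i. E \<subseteq> [{..<n}]\<^bsup>2\<^esup> \<Longrightarrow> i < 2 \<Longrightarrow> queries A E i \<subseteq> [{..<n}]\<^bsup>2\<^esup>"
    and few: "\<And>E i. E \<subseteq> [{..<n}]\<^bsup>2\<^esup> \<Longrightarrow> i < 2 \<Longrightarrow>
      real (card (queries A E i)) \<le> real n powr ([3/2 - \<delta>/4, \<delta>] ! i)"
  shows "measure_pmf.prob (random_graph n (1/2))
           {E. \<exists>C\<subseteq>{..<n}. clique C (revealed_graph A E 2) \<and> card C \<ge> k}
         \<le> (real k + 1) * 2 powr (real k + L - (a - 1 - \<delta>/2) * (\<delta>/2) * L\<^sup>2)"
proof -
  let ?V = "{..<n}"
  let ?P = "[?V]\<^bsup>2\<^esup>"
  define Q where "Q = A []"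
  define R where "R B = A [B]" for B
  \<comment> \<open>The counting lemma needs a natural number as its query bound.\<close>
  define q where "q = nat \<lfloor>real n powr \<delta>\<rfloor>"
  have q0: "queries A E 0 = Q" for E by (simp add: queries_def Q_def)
  have q1: "queries A E 1 = R (E \<inter> Q)" for E by (simp add: queries_def Q_def R_def Int_commute)
  have finP: "finite ?P" by (simp add: finite_imp_finite_nsets)
  have Q: "Q \<subseteq> ?P" "real (card Q) \<le> real n powr (3/2 - \<delta>/4)"
    using valid[of "{}" 0] few[of "{}" 0] by (auto simp: q0)
  have R: "R B \<subseteq> ?P" "card (R B) \<le> q" if "B \<subseteq> Q" for B
  proof -
    \<comment> \<open>Every \<open>B \<subseteq> Q\<close> occurs as a first-round answer, namely
      for the graph \<open>B\<close> itself, so the query bounds apply to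
      \<open>R B\<close>.\<close>
    have "B \<subseteq> ?P" "B \<inter> Q = B" using that Q(1) by auto
    then have "R B \<subseteq> ?P" "real (card (R B)) \<le> real n powr \<delta>"
      using valid[of B 1] few[of B 1] unfolding q1 by auto
    then show "R B \<subseteq> ?P" "card (R B) \<le> q"
      unfolding q_def by (auto simp: le_nat_iff le_floor_iff)
  qed
  have qle: "real q \<le> real n powr \<delta>" unfolding q_def by (simp add: of_nat_nat)
  define W where "W = {E \<in> Pow ?P. \<exists>C\<subseteq>?V. card C = k \<and> [C]\<^bsup>2\<^esup> \<subseteq> (Q \<union> R (E \<inter> Q)) \<inter> E}"
  have rev: "revealed_graph A E 2 = (Q \<union> R (E \<inter> Q)) \<inter> E" for E
    using q0 q1 by (auto simp: revealed_graph_def numeral_2_eq_2 lessThan_Suc)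
  have "Pow ?P \<inter> {E. \<exists>C\<subseteq>?V. clique C (revealed_graph A E 2) \<and> card C \<ge> k} \<subseteq> W"
  proof
    fix E assume "E \<in> Pow ?P \<inter> {E. \<exists>C\<subseteq>?V. clique C (revealed_graph A E 2) \<and> card C \<ge> k}"
    then obtain C where C: "E \<in> Pow ?P" "C \<subseteq> ?V" "clique C (revealed_graph A E 2)" "card C \<ge> k" by blast
    \<comment> \<open>The counting treats cliques of size exactly \<open>k\<close>, so a larger
      clique is cut down.\<close>
    obtain D where D: "D \<subseteq> C" "card D = k" using C(4) by (meson obtain_subset_with_card_n)
    have "[D]\<^bsup>2\<^esup> \<subseteq> revealed_graph A E 2"
    proof
      fix e assume "e \<in> [D]\<^bsup>2\<^esup>"
      then obtain x y where "e = {x, y}" "x \<in> D" "y \<in> D" "x \<noteq> y" by (rule nsets2_E)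
      then show "e \<in> revealed_graph A E 2" using C(3) D(1) unfolding clique_def by blast
    qed
    then show "E \<in> W" using C D unfolding W_def rev by blast
  qed
  then have "card (Pow ?P \<inter> {E. \<exists>C\<subseteq>?V. clique C (revealed_graph A E 2) \<and> card C \<ge> k}) \<le> card W"
    using finP by (intro card_mono) (auto simp: W_def)
  then have pr: "measure_pmf.prob (random_graph n (1/2))
           {E. \<exists>C\<subseteq>?V. clique C (revealed_graph A E 2) \<and> card C \<ge> k} \<le> card W / 2 ^ card ?P"
    unfolding random_graph_half using finP
    by (subst measure_pmf_of_set) (auto simp: card_Pow intro!: divide_right_mono simp del: card_nsets)
  define T where "T m = card Q ^ m * min (q ^ ((k - 2 * m) div 2) * n ^ ((k - 2 * m) mod 2)
          * 2 ^ (m * (k - 2 * m + 1))) (n ^ (k - 2 * m))" for m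
  let ?b = "2 powr (real k * (real k - 1) / 2 + real k + L - (a - 1 - \<delta>/2) * (\<delta>/2) * L\<^sup>2)"
  have "card W * 2 ^ (k choose 2) \<le> (\<Sum>m\<le>k div 2. T m) * 2 ^ card ?P"
    using card_two_round_cliques_le[of ?V Q R q k] Q(1) R unfolding W_def T_def by simp
  then have "real (card W * 2 ^ (k choose 2)) \<le> real ((\<Sum>m\<le>k div 2. T m) * 2 ^ card ?P)"
    by (rule of_nat_mono)
  then have "real (card W) / 2 ^ card ?P * 2 ^ (k choose 2) \<le> (\<Sum>m\<le>k div 2. real (T m))"
    by (simp add: field_simps del: card_nsets)
  also have "\<dots> \<le> (\<Sum>m\<le>k div 2. ?b)"
    unfolding T_def L_def
    by (intro sum_mono union_bound_term_le[OF \<delta> n a(1) _ Q(2) qle]) (use a in \<open>auto simp: L_def\<close>)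
  also have "\<dots> = (real (k div 2) + 1) * ?b" by simp
  also have "\<dots> \<le> (real k + 1) * ?b" by (intro mult_right_mono) auto
  also have "?b = 2 powr (real k + L - (a - 1 - \<delta>/2) * (\<delta>/2) * L\<^sup>2) * 2 ^ (k choose 2)"
  proof -
    have "real (k choose 2) = real k * (real k - 1) / 2"
      by (cases k) (auto simp: choose_two real_of_nat_div algebra_simps)
    then have "2 ^ (k choose 2) = 2 powr (real k * (real k - 1) / 2)"
      by (metis powr_realpow zero_less_numeral)
    then show ?thesis by (simp flip: powr_add add: algebra_simps)
  qed
  finally have "real (card W) / 2 ^ card ?P
      \<le> (real k + 1) * 2 powr (real k + L - (a - 1 - \<delta>/2) * (\<delta>/2) * L\<^sup>2)"
    unfolding mult.assoc[symmetric] by (rule mult_right_le_imp_le) simp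
  then show ?thesis using pr by linarith
qed

theorem theorem3:
  fixes \<delta> :: real
  assumes "6/5 < \<delta>" and "\<delta> < 2"
  shows "alpha_star [3/2 - \<delta>/4, \<delta>] 2 \<le> 1 + \<delta>/2"
proof -
  let ?\<delta>s = "[3/2 - \<delta>/4, \<delta>]"
  have "\<alpha> \<le> 1 + \<delta>/2" if A: "is_clique_algorithm ?\<delta>s 2 \<alpha> A" for \<alpha> A
  proof (rule ccontr)
    assume "\<not> \<alpha> \<le> 1 + \<delta>/2"
    \<comment> \<open>The room between \<open>a\<close> and \<open>\<alpha>\<close> absorbs the
      \<open>o(log n)\<close> error, and the room between \<open>1 + \<delta>/2\<close> and
      \<open>a\<close> makes the probability vanish.\<close>
    then obtain a where a: "1 + \<delta>/2 < a" "a < \<alpha>" using dense[of "1 + \<delta>/2" \<alpha>] by auto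
    have "\<alpha> \<le> 2"
      and valid: "\<And>n E i. E \<subseteq> [{..<n}]\<^bsup>2\<^esup> \<Longrightarrow> i < 2 \<Longrightarrow> queries (A n) E i \<subseteq> [{..<n}]\<^bsup>2\<^esup>"
      and few: "\<And>n E i. E \<subseteq> [{..<n}]\<^bsup>2\<^esup> \<Longrightarrow> i < 2 \<Longrightarrow>
        real (card (queries (A n) E i)) \<le> real n powr (?\<delta>s ! i)"
      using A unfolding is_clique_algorithm_def by auto
    obtain f where f: "f \<in> o(\<lambda>n. log 2 (real n))"
      and prob: "\<forall>\<^sub>F n in sequentially. measure_pmf.prob (random_graph n (1/2))
             {E. \<exists>C \<subseteq> {..<n}. clique C (revealed_graph (A n) E 2) \<and>
                   real (card C) \<ge> \<alpha> * log 2 (real n) - f n} \<ge> 1/2"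
      using A unfolding is_clique_algorithm_def by auto
    define c where "c = (a - 1 - \<delta>/2) * (\<delta>/2)"
    have c: "c > 0" using a assms unfolding c_def by simp
    \<comment> \<open>The probability bound with \<open>k\<close> replaced by its upper bound
      \<open>2 * L + 1\<close>; the quadratic term beats the linear ones.\<close>
    have "((\<lambda>L::real. (2 * L + 2) * 2 powr (3 * L + 1 - c * L\<^sup>2)) \<longlongrightarrow> 0) at_top"
      using c by real_asymp
    moreover have "filterlim (\<lambda>n. log 2 (real n)) at_top sequentially" by real_asymp
    ultimately have "((\<lambda>n. (2 * log 2 (real n) + 2) *
        2 powr (3 * log 2 (real n) + 1 - c * (log 2 (real n))\<^sup>2)) \<longlongrightarrow> 0) sequentially"
      by (rule filterlim_compose)
    then have small: "\<forall>\<^sub>F n in sequentially. (2 * log 2 (real n) + 2) *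
        2 powr (3 * log 2 (real n) + 1 - c * (log 2 (real n))\<^sup>2) < 1/2"
      by (rule order_tendstoD(2)) simp
    have fsmall: "\<forall>\<^sub>F n in sequentially. norm (f n) \<le> (\<alpha> - a) * norm (log 2 (real n))"
      using landau_o.smallD[OF f, of "\<alpha> - a"] a by simp
    have "\<forall>\<^sub>F n in sequentially. False"
      using prob small fsmall eventually_ge_at_top[of 2]
    proof eventually_elim
      case (elim n)
      define L where "L = log 2 (real n)"
      define k where "k = nat \<lceil>a * L\<rceil>"
      have L: "0 < L" using elim(4) unfolding L_def by simp
      have aL: "0 \<le> a * L" using a assms L by simp
      then have k: "a * L \<le> real k" "real k \<le> a * L + 1" unfolding k_def by linarith+
      \<comment> \<open>The condition \<open>\<alpha> \<le> 2\<close> keeps \<open>k\<close> linear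
        in \<open>L\<close>.\<close>
      have "a * L \<le> 2 * L" using a \<open>\<alpha> \<le> 2\<close> L by (intro mult_right_mono) auto
      then have k2: "real k \<le> 2 * L + 1" using k by linarith
      have "f n \<le> (\<alpha> - a) * L" using elim(3) L unfolding L_def[symmetric] by simp
      then have "a * L \<le> \<alpha> * L - f n" by (simp add: algebra_simps)
      then have "card C \<ge> k" if "real (card C) \<ge> \<alpha> * L - f n" for C :: "nat set"
        using that unfolding k_def by (simp add: nat_le_iff ceiling_le_iff)
      then have "1/2 \<le> measure_pmf.prob (random_graph n (1/2))
             {E. \<exists>C \<subseteq> {..<n}. clique C (revealed_graph (A n) E 2) \<and> card C \<ge> k}"
        using elim(1) unfolding L_def[symmetric]
        by (elim order_trans) (intro measure_pmf.finite_measure_mono, auto)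
      also have "\<dots> \<le> (real k + 1) * 2 powr (real k + L - c * L\<^sup>2)"
        unfolding c_def L_def
        by (rule prob_two_round_clique_le[OF assms elim(4) _ _ valid few])
           (use a k in \<open>auto simp: L_def\<close>)
      also have "\<dots> \<le> (2 * L + 2) * 2 powr (3 * L + 1 - c * L\<^sup>2)"
        using k2 L by (intro mult_mono powr_mono) auto
      also have "\<dots> < 1/2" using elim(2) unfolding L_def .
      finally show ?case by simp
    qed
    then show False by simp
  qed
  \<comment> \<open>A real \<open>Sup\<close> is bounded by an upper bound of the set only if the
    set is nonempty.\<close>
  moreover have "{\<alpha>. \<exists>A. is_clique_algorithm ?\<delta>s 2 \<alpha> A} \<noteq> {}"
    using assms by (intro alpha_star_nonempty) (auto simp: less_2_cases_iff)
  ultimately show ?thesis unfolding alpha_star_def by (intro cSup_least) auto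
qed

end
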